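(* Let $\mathbb{C}$ be a pointed category with binary products and coequalisers in which binary products commute with coequalisers, and suppose that $\mathbb{C}$ satisfies the condition $\mathsf{(T)}$: for every object $X$ and all morphisms $\phi\colon X\times X\to Y$ and $f\colon X\to Y$ with $\phi\circ(1_X,0)=f=\phi\circ(0,1_X)$, if $\phi$ is a regular epimorphism then so is $f$. Then the category $\mathsf{Ab}(\mathbb{C})$ of abelian objects in $\mathbb{C}$ is a reflective subcategory of the category $\mathsf{Com}(\mathbb{C})$ of commutative objects in $\mathbb{C}$.
   Context: A pointed category is a category with a zero object $0$; zero morphisms are also denoted $0$. Binary products commute with coequalisers in $\mathbb{C}$ if for any two coequaliser diagrams $C_1\rightrightarrows X_1\xrightarrow{q_1}Q_1$ (of $u_1,v_1$) and $C_2\rightrightarrows X_2\xrightarrow{q_2}Q_2$ (of $u_2,v_2$), the morphism $q_1\times q_2$ is a coequaliser of $u_1\times u_2$ and $v_1\times v_2$. Two morphisms $f\colon A\to X$ and $g\colon B\to X$ commute if there is a morphism $\rho\colon A\times B\to X$ (a cooperator for $f$ and $g$) with $\rho\circ(1_A,0)=f$ and $\rho\circ(0,1_B)=g$. A morphism $f\colon A\to B$ is central if it commutes with $1_B$; an object $X$ is commutative if $1_X$ is central. Under the present hypotheses a central $f\colon X\to Y$ and any $g\colon X'\to Y$ have a unique cooperator $\rho_{f,g}\colon X\times X'\to Y$, and the set $\mathsf{Z}(X,Y)$ of central morphisms $X\to Y$ is a commutative monoid under $f+g=\rho_{f,g}\circ(1_X,1_X)$ with unit $0$. A morphism $f\colon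 X\to Y$ is symmetrizable if it is central and has an inverse in the monoid $\mathsf{Z}(X,Y)$. A commutative object $X$ is abelian if $1_X$ is symmetrizable. $\mathsf{Com}(\mathbb{C})$ and $\mathsf{Ab}(\mathbb{C})$ are the full subcategories of $\mathbb{C}$ on the commutative, respectively abelian, objects. *)

theory Defs
  imports "HOL-Algebra.Group"
begin

section \<open>Categories\<close>

record ('o, 'm) cat =
  Obj :: "'o set"
  Arr :: "'m set"
  Dom :: "'m \<Rightarrow> 'o"
  Cod :: "'m \<Rightarrow> 'o"
  Ident :: "'o \<Rightarrow> 'm"
  Comp :: "'m \<Rightarrow> 'm \<Rightarrow> 'm" (infixl "\<cdot>\<index>" 70)

definition Hom :: "('o, 'm, 'z) cat_scheme \<Rightarrow> 'o \<Rightarrow> 'o \<Rightarrow> 'm set" where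
  "Hom C A B = {f \<in> Arr C. Dom C f = A \<and> Cod C f = B}"

locale category =
  fixes C :: "('o, 'm, 'z) cat_scheme" (structure)
  assumes Dom_Obj: "f \<in> Arr C \<Longrightarrow> Dom C f \<in> Obj C"
    and Cod_Obj: "f \<in> Arr C \<Longrightarrow> Cod C f \<in> Obj C"
    and Ident_Hom: "A \<in> Obj C \<Longrightarrow> Ident C A \<in> Hom C A A"
    and Comp_Hom: "f \<in> Hom C X Y \<Longrightarrow> g \<in> Hom C Y Z \<Longrightarrow> g \<cdot> f \<in> Hom C X Z"
    and Comp_Ident_right: "f \<in> Hom C X Y \<Longrightarrow> f \<cdot> Ident C X = f"
    and Comp_Ident_left: "f \<in> Hom C X Y \<Longrightarrow> Ident C Y \<cdot> f = f"
    and Comp_assoc: "f \<in> Hom C W X \<Longrightarrow> g \<in> Hom C X Y \<Longrightarrow> h \<in> Hom C Y Z \<Longrightarrow>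
          (h \<cdot> g) \<cdot> f = h \<cdot> (g \<cdot> f)"

section \<open>Functors, adjunctions, reflective subcategories\<close>

record ('o1, 'm1, 'o2, 'm2) cat_functor =
  Fobj :: "'o1 \<Rightarrow> 'o2"
  Farr :: "'m1 \<Rightarrow> 'm2"

definition is_functor ::
  "('o1, 'm1) cat \<Rightarrow> ('o2, 'm2) cat \<Rightarrow> ('o1, 'm1, 'o2, 'm2) cat_functor \<Rightarrow> bool" where
  "is_functor C D F \<longleftrightarrow> category C \<and> category D \<and>
     (\<forall>A\<in>Obj C. Fobj F A \<in> Obj D) \<and>
     (\<forall>A B. \<forall>f\<in>Hom C A B. Farr F f \<in> Hom D (Fobj F A) (Fobj F B)) \<and>
     (\<forall>A\<in>Obj C. Farr F (Ident C A) = Ident D (Fobj F A)) \<and>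
     (\<forall>X Y Z. \<forall>f\<in>Hom C X Y. \<forall>g\<in>Hom C Y Z.
        Farr F (g \<cdot>\<^bsub>C\<^esub> f) = Farr F g \<cdot>\<^bsub>D\<^esub> Farr F f)"

definition left_adjoint ::
  "('o1, 'm1) cat \<Rightarrow> ('o2, 'm2) cat \<Rightarrow> ('o1, 'm1, 'o2, 'm2) cat_functor \<Rightarrow>
   ('o2, 'm2, 'o1, 'm1) cat_functor \<Rightarrow> bool" where
  "left_adjoint C D L R \<longleftrightarrow> is_functor C D L \<and> is_functor D C R \<and>
     (\<exists>\<Phi>.
        (\<forall>A\<in>Obj C. \<forall>B\<in>Obj D. bij_betw (\<Phi> A B) (Hom D (Fobj L A) B) (Hom C A (Fobj R B))) \<and>
        (\<forall>A\<in>Obj C. \<forall>A'\<in>Obj C. \<forall>B\<in>Obj D. \<forall>B'\<in>Obj D.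
           \<forall>a\<in>Hom C A' A. \<forall>b\<in>Hom D B B'. \<forall>h\<in>Hom D (Fobj L A) B.
             \<Phi> A' B' ((b \<cdot>\<^bsub>D\<^esub> h) \<cdot>\<^bsub>D\<^esub> Farr L a) = (Farr R b \<cdot>\<^bsub>C\<^esub> \<Phi> A B h) \<cdot>\<^bsub>C\<^esub> a))"

definition full_subcategory :: "('o, 'm) cat \<Rightarrow> ('o, 'm) cat \<Rightarrow> bool" where
  "full_subcategory D C \<longleftrightarrow> category D \<and> category C \<and> Obj D \<subseteq> Obj C \<and>
     (\<forall>A\<in>Obj D. \<forall>B\<in>Obj D. Hom D A B = Hom C A B) \<and>
     (\<forall>A\<in>Obj D. Ident D A = Ident C A) \<and>
     (\<forall>X Y Z. \<forall>f\<in>Hom D X Y. \<forall>g\<in>Hom D Y Z. g \<cdot>\<^bsub>D\<^esub> f = g \<cdot>\<^bsub>C\<^esub> f)"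

definition inclusion :: "('o, 'm, 'o, 'm) cat_functor" where
  "inclusion = \<lparr>Fobj = (\<lambda>X. X), Farr = (\<lambda>f. f)\<rparr>"

definition reflective_subcategory :: "('o, 'm) cat \<Rightarrow> ('o, 'm) cat \<Rightarrow> bool" where
  "reflective_subcategory D C \<longleftrightarrow> full_subcategory D C \<and> (\<exists>L. left_adjoint C D L inclusion)"

definition full_subcat :: "('o, 'm) cat \<Rightarrow> 'o set \<Rightarrow> ('o, 'm) cat" where
  "full_subcat C S = C\<lparr>Obj := S, Arr := {f \<in> Arr C. Dom C f \<in> S \<and> Cod C f \<in> S}\<rparr>"

section \<open>Zero objects, binary products, coequalisers\<close>

definition zero_object :: "('o, 'm) cat \<Rightarrow> 'o \<Rightarrow> bool" where
  "zero_object C Z \<longleftrightarrow> Z \<in> Obj C \<and>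
     (\<forall>A\<in>Obj C. (\<exists>!f. f \<in> Hom C A Z) \<and> (\<exists>!f. f \<in> Hom C Z A))"

definition pointed :: "('o, 'm) cat \<Rightarrow> bool" where
  "pointed C \<longleftrightarrow> (\<exists>Z. zero_object C Z)"

text \<open>The composite through a zero object does not depend on which one is used, so the
  description below is proper in a pointed category.\<close>

definition zero_arr :: "('o, 'm) cat \<Rightarrow> 'o \<Rightarrow> 'o \<Rightarrow> 'm" where
  "zero_arr C A B =
     (THE h. \<exists>Z. zero_object C Z \<and> (\<exists>f\<in>Hom C A Z. \<exists>g\<in>Hom C Z B. h = g \<cdot>\<^bsub>C\<^esub> f))"

definition is_product :: "('o, 'm) cat \<Rightarrow> 'o \<Rightarrow> 'o \<Rightarrow> 'o \<Rightarrow> 'm \<Rightarrow> 'm \<Rightarrow> bool" where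
  "is_product C A B P p q \<longleftrightarrow> P \<in> Obj C \<and> p \<in> Hom C P A \<and> q \<in> Hom C P B \<and>
     (\<forall>T\<in>Obj C. \<forall>f\<in>Hom C T A. \<forall>g\<in>Hom C T B.
        \<exists>!h. h \<in> Hom C T P \<and> p \<cdot>\<^bsub>C\<^esub> h = f \<and> q \<cdot>\<^bsub>C\<^esub> h = g)"

definition has_binary_products :: "('o, 'm) cat \<Rightarrow> bool" where
  "has_binary_products C \<longleftrightarrow> (\<forall>A\<in>Obj C. \<forall>B\<in>Obj C. \<exists>P p q. is_product C A B P p q)"

text \<open>A product diagram is chosen for each pair of objects; every notion below that refers to
  the chosen products is invariant under the canonical isomorphisms between products.\<close>

definition product_cone :: "('o, 'm) cat \<Rightarrow> 'o \<Rightarrow> 'o \<Rightarrow> 'o \<times> 'm \<times> 'm" where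
  "product_cone C A B = (SOME (P, p, q). is_product C A B P p q)"

definition prod_obj :: "('o, 'm) cat \<Rightarrow> 'o \<Rightarrow> 'o \<Rightarrow> 'o" where
  "prod_obj C A B = fst (product_cone C A B)"

definition proj1 :: "('o, 'm) cat \<Rightarrow> 'o \<Rightarrow> 'o \<Rightarrow> 'm" where
  "proj1 C A B = fst (snd (product_cone C A B))"

definition proj2 :: "('o, 'm) cat \<Rightarrow> 'o \<Rightarrow> 'o \<Rightarrow> 'm" where
  "proj2 C A B = snd (snd (product_cone C A B))"

text \<open>\<open>pair_arr C f g\<close> is the morphism \<open>(f, g)\<close> into the product induced by \<open>f\<close> and \<open>g\<close>
  with common domain; \<open>prod_arr C f g\<close> is \<open>f \<times> g\<close>.\<close>

definition pair_arr :: "('o, 'm) cat \<Rightarrow> 'm \<Rightarrow> 'm \<Rightarrow> 'm" where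
  "pair_arr C f g =
     (THE h. h \<in> Hom C (Dom C f) (prod_obj C (Cod C f) (Cod C g)) \<and>
        proj1 C (Cod C f) (Cod C g) \<cdot>\<^bsub>C\<^esub> h = f \<and> proj2 C (Cod C f) (Cod C g) \<cdot>\<^bsub>C\<^esub> h = g)"

definition prod_arr :: "('o, 'm) cat \<Rightarrow> 'm \<Rightarrow> 'm \<Rightarrow> 'm" where
  "prod_arr C f g =
     pair_arr C (f \<cdot>\<^bsub>C\<^esub> proj1 C (Dom C f) (Dom C g)) (g \<cdot>\<^bsub>C\<^esub> proj2 C (Dom C f) (Dom C g))"

definition is_coequaliser :: "('o, 'm) cat \<Rightarrow> 'm \<Rightarrow> 'm \<Rightarrow> 'm \<Rightarrow> bool" where
  "is_coequaliser C u v q \<longleftrightarrow>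
     u \<in> Arr C \<and> v \<in> Hom C (Dom C u) (Cod C u) \<and> q \<in> Arr C \<and> Dom C q = Cod C u \<and>
     q \<cdot>\<^bsub>C\<^esub> u = q \<cdot>\<^bsub>C\<^esub> v \<and>
     (\<forall>h\<in>Arr C. Dom C h = Cod C u \<longrightarrow> h \<cdot>\<^bsub>C\<^esub> u = h \<cdot>\<^bsub>C\<^esub> v \<longrightarrow>
        (\<exists>!k. k \<in> Hom C (Cod C q) (Cod C h) \<and> k \<cdot>\<^bsub>C\<^esub> q = h))"

definition has_coequalisers :: "('o, 'm) cat \<Rightarrow> bool" where
  "has_coequalisers C \<longleftrightarrow>
     (\<forall>X Y. \<forall>u\<in>Hom C X Y. \<forall>v\<in>Hom C X Y. \<exists>q. is_coequaliser C u v q)"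

definition regular_epi :: "('o, 'm) cat \<Rightarrow> 'm \<Rightarrow> bool" where
  "regular_epi C q \<longleftrightarrow> (\<exists>u v. is_coequaliser C u v q)"

definition products_commute_with_coequalisers :: "('o, 'm) cat \<Rightarrow> bool" where
  "products_commute_with_coequalisers C \<longleftrightarrow>
     (\<forall>u1 v1 q1 u2 v2 q2. is_coequaliser C u1 v1 q1 \<longrightarrow> is_coequaliser C u2 v2 q2 \<longrightarrow>
        is_coequaliser C (prod_arr C u1 u2) (prod_arr C v1 v2) (prod_arr C q1 q2))"

text \<open>The morphisms \<open>(1\<^sub>A, 0) : A \<rightarrow> A \<times> B\<close> and \<open>(0, 1\<^sub>B) : B \<rightarrow> A \<times> B\<close>.\<close>

definition inj1 :: "('o, 'm) cat \<Rightarrow> 'o \<Rightarrow> 'o \<Rightarrow> 'm" where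
  "inj1 C A B = pair_arr C (Ident C A) (zero_arr C A B)"

definition inj2 :: "('o, 'm) cat \<Rightarrow> 'o \<Rightarrow> 'o \<Rightarrow> 'm" where
  "inj2 C A B = pair_arr C (zero_arr C B A) (Ident C B)"

definition condition_T :: "('o, 'm) cat \<Rightarrow> bool" where
  "condition_T C \<longleftrightarrow>
     (\<forall>X\<in>Obj C. \<forall>Y\<in>Obj C. \<forall>\<phi>\<in>Hom C (prod_obj C X X) Y. \<forall>f\<in>Hom C X Y.
        \<phi> \<cdot>\<^bsub>C\<^esub> inj1 C X X = f \<longrightarrow> f = \<phi> \<cdot>\<^bsub>C\<^esub> inj2 C X X \<longrightarrow>
        regular_epi C \<phi> \<longrightarrow> regular_epi C f)"

section \<open>Commutative and abelian objects\<close>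

definition is_cooperator :: "('o, 'm) cat \<Rightarrow> 'm \<Rightarrow> 'm \<Rightarrow> 'm \<Rightarrow> bool" where
  "is_cooperator C f g \<rho> \<longleftrightarrow> f \<in> Arr C \<and> g \<in> Arr C \<and> Cod C g = Cod C f \<and>
     \<rho> \<in> Hom C (prod_obj C (Dom C f) (Dom C g)) (Cod C f) \<and>
     \<rho> \<cdot>\<^bsub>C\<^esub> inj1 C (Dom C f) (Dom C g) = f \<and> \<rho> \<cdot>\<^bsub>C\<^esub> inj2 C (Dom C f) (Dom C g) = g"

definition commute :: "('o, 'm) cat \<Rightarrow> 'm \<Rightarrow> 'm \<Rightarrow> bool" where
  "commute C f g \<longleftrightarrow> (\<exists>\<rho>. is_cooperator C f g \<rho>)"

definition central :: "('o, 'm) cat \<Rightarrow> 'm \<Rightarrow> bool" where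
  "central C f \<longleftrightarrow> commute C f (Ident C (Cod C f))"

definition commutative_object :: "('o, 'm) cat \<Rightarrow> 'o \<Rightarrow> bool" where
  "commutative_object C X \<longleftrightarrow> X \<in> Obj C \<and> central C (Ident C X)"

text \<open>Cooperators need not be unique in an arbitrary pointed category; \<open>cooperator\<close> is
  meaningful for central \<open>f\<close> when binary products commute with coequalisers.\<close>

definition cooperator :: "('o, 'm) cat \<Rightarrow> 'm \<Rightarrow> 'm \<Rightarrow> 'm" where
  "cooperator C f g = (THE \<rho>. is_cooperator C f g \<rho>)"

definition central_monoid :: "('o, 'm) cat \<Rightarrow> 'o \<Rightarrow> 'o \<Rightarrow> 'm monoid" where
  "central_monoid C X Y =
     \<lparr>carrier = {f \<in> Hom C X Y. central C f},
      monoid.mult = (\<lambda>f g. cooperator C f g \<cdot>\<^bsub>C\<^esub> pair_arr C (Ident C X) (Ident C X)),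
      one = zero_arr C X Y\<rparr>"

definition symmetrizable :: "('o, 'm) cat \<Rightarrow> 'm \<Rightarrow> bool" where
  "symmetrizable C f \<longleftrightarrow> f \<in> Arr C \<and> central C f \<and>
     f \<in> Units (central_monoid C (Dom C f) (Cod C f))"

definition abelian_object :: "('o, 'm) cat \<Rightarrow> 'o \<Rightarrow> bool" where
  "abelian_object C X \<longleftrightarrow> commutative_object C X \<and> symmetrizable C (Ident C X)"

definition Com :: "('o, 'm) cat \<Rightarrow> ('o, 'm) cat" where
  "Com C = full_subcat C {X. commutative_object C X}"

definition Ab :: "('o, 'm) cat \<Rightarrow> ('o, 'm) cat" where
  "Ab C = full_subcat C {X. abelian_object C X}"

end

theory Submission imports Defs begin

text \<open>The reflection of a commutative object \<open>X\<close> is its group completion, built as for commutative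
  monoids: the cokernel \<open>q : X \<times> X \<rightarrow> Q\<close> of the diagonal, with unit \<open>\<eta> = q \<circ> (1, 0)\<close>. One thinks of
  \<open>q (a, b)\<close> as the formal difference \<open>a - b\<close>; killing the diagonal says \<open>a - a = 0\<close>.

  Since \<open>q \<times> q\<close> is again a coequaliser, of \<open>\<Delta> \<times> \<Delta>\<close> and \<open>0\<close>, the componentwise addition of \<open>X \<times> X\<close>
  descends to \<open>Q\<close>. Exchanging the two components descends as well and gives the inverse, because
  \<open>(a, b) + (b, a)\<close> lies on the diagonal. So \<open>Q\<close> is abelian. A morphism \<open>h\<close> from \<open>X\<close> to an abelian
  object extends to \<open>Q\<close> through \<open>(a, b) \<mapsto> h a - h b\<close>, which kills the diagonal.

  Everything else rests on one consequence of the interchange of products and coequalisers, lemma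
  \<open>coequalise_slice\<close>: if a morphism out of \<open>B \<times> E\<close> identifies \<open>(u, 0)\<close> with \<open>(v, 0)\<close>, it identifies
  \<open>u \<times> 1\<close> with \<open>v \<times> 1\<close>. From it follows \<open>cooperator_eq\<close>, the uniqueness of cooperators of a central
  morphism, by an argument of Eckmann-Hilton type. In particular a morphism from \<open>A \<times> B\<close> to a
  commutative object is the sum of its restrictions to \<open>A\<close> and \<open>B\<close>. This makes the addition of a
  commutative object commutative and associative, hence inverses unique, and it makes the
  extension of \<open>h\<close> to \<open>Q\<close> unique.\<close>

section \<open>Full subcategories with universal arrows\<close>

lemma Hom_full_subcat:
  "Hom (full_subcat C S) A B = (if A \<in> S \<and> B \<in> S then Hom C A B else {})"
  by (auto simp: Hom_def full_subcat_def)

lemma full_subcat_simps [simp]: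
  "Obj (full_subcat C S) = S"
  "Ident (full_subcat C S) = Ident C"
  "Comp (full_subcat C S) = Comp C"
  "Dom (full_subcat C S) = Dom C"
  "Cod (full_subcat C S) = Cod C"
  by (simp_all add: full_subcat_def)

lemma category_full_subcat:
  fixes C :: "('o, 'm) cat"
  assumes "category C" "S \<subseteq> Obj C"
  shows "category (full_subcat C S)"
proof -
  interpret category C by fact
  show ?thesis
  proof
    fix f assume "f \<in> Arr (full_subcat C S)"
    then show "Dom (full_subcat C S) f \<in> Obj (full_subcat C S)"
      "Cod (full_subcat C S) f \<in> Obj (full_subcat C S)"
      by (auto simp: full_subcat_def)
  next
    fix A assume "A \<in> Obj (full_subcat C S)"
    then show "Ident (full_subcat C S) A \<in> Hom (full_subcat C S) A A"
      using assms(2) Ident_Hom by (auto simp: Hom_full_subcat)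
  qed (auto simp: Hom_full_subcat Comp_Hom Comp_Ident_left Comp_Ident_right Comp_assoc
      split: if_splits)
qed

lemma full_subcategory_full_subcat:
  fixes C :: "('o, 'm) cat"
  assumes "category C" "S' \<subseteq> S" "S \<subseteq> Obj C"
  shows "full_subcategory (full_subcat C S') (full_subcat C S)"
  using assms category_full_subcat[of C S] category_full_subcat[of C S']
  by (auto simp: full_subcategory_def Hom_full_subcat subset_iff)

lemma is_functor_inclusion:
  assumes "full_subcategory D C"
  shows "is_functor D C inclusion"
proof -
  from assms have D: "category D" and C: "category C" by (auto simp: full_subcategory_def)
  have "f \<in> Hom C A B" if f: "f \<in> Hom D A B" for f A B
  proof -
    have "A \<in> Obj D" "B \<in> Obj D"
      using f category.Dom_Obj[OF D] category.Cod_Obj[OF D] by (auto simp: Hom_def)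
    with assms f show ?thesis by (auto simp: full_subcategory_def)
  qed
  with assms C D show ?thesis
    unfolding full_subcategory_def is_functor_def inclusion_def by auto
qed

text \<open>A universal arrow from every object to the smaller subcategory determines the left adjoint:
  on a morphism \<open>f\<close> it is the unique lift of \<open>\<eta> \<circ> f\<close>, and functoriality and naturality follow by
  cancelling \<open>\<eta>\<close>.\<close>

theorem reflective_full_subcatI:
  fixes C :: "('o, 'm) cat" (structure)
  assumes C: "category C" and sub: "S' \<subseteq> S" "S \<subseteq> Obj C"
    and univ: "\<And>A. A \<in> S \<Longrightarrow> \<exists>L\<in>S'. \<exists>\<eta>\<in>Hom C A L.
      \<forall>B\<in>S'. \<forall>h\<in>Hom C A B. \<exists>!k. k \<in> Hom C L B \<and> k \<cdot>\<^bsub>C\<^esub> \<eta> = h"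
  shows "reflective_subcategory (full_subcat C S') (full_subcat C S)"
proof -
  interpret category C by fact
  obtain L \<eta> where L: "\<And>A. A \<in> S \<Longrightarrow> L A \<in> S'" and \<eta>: "\<And>A. A \<in> S \<Longrightarrow> \<eta> A \<in> Hom C A (L A)"
    and ex1: "\<And>A B h. A \<in> S \<Longrightarrow> B \<in> S' \<Longrightarrow> h \<in> Hom C A B \<Longrightarrow>
        \<exists>!k. k \<in> Hom C (L A) B \<and> k \<cdot> \<eta> A = h"
    using univ by metis
  define lift where "lift A B h = (THE k. k \<in> Hom C (L A) B \<and> k \<cdot> \<eta> A = h)" for A B h
  have lift: "lift A B h \<in> Hom C (L A) B" "lift A B h \<cdot> \<eta> A = h"
    if "A \<in> S" "B \<in> S'" "h \<in> Hom C A B" for A B h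
    using theI'[OF ex1[OF that]] by (auto simp: lift_def)
  have cancel: "k = k'"
    if "A \<in> S" "B \<in> S'" "k \<in> Hom C (L A) B" "k' \<in> Hom C (L A) B" "k \<cdot> \<eta> A = k' \<cdot> \<eta> A"
    for A B k k'
    using ex1[OF that(1,2) Comp_Hom[OF \<eta>[OF that(1)] that(4)]] that by auto
  define F where "F = \<lparr>Fobj = L, Farr = (\<lambda>f. lift (Dom C f) (L (Cod C f)) (\<eta> (Cod C f) \<cdot> f))\<rparr>"
  have Farr: "Farr F f \<in> Hom C (L A) (L B)" "Farr F f \<cdot> \<eta> A = \<eta> B \<cdot> f"
    if "A \<in> S" "B \<in> S" "f \<in> Hom C A B" for A B f
    using that lift[OF that(1) L[OF that(2)] Comp_Hom[OF that(3) \<eta>[OF that(2)]]]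
    by (auto simp: F_def Hom_def)
  have id: "Farr F (Ident C A) = Ident C (L A)" if A: "A \<in> S" for A
  proof (rule cancel[OF A L[OF A]])
    have iA: "Ident C A \<in> Hom C A A" using A sub by (auto intro: Ident_Hom)
    show "Farr F (Ident C A) \<in> Hom C (L A) (L A)" using Farr(1)[OF A A iA] .
    show "Ident C (L A) \<in> Hom C (L A) (L A)" using L[OF A] sub by (auto intro: Ident_Hom)
    show "Farr F (Ident C A) \<cdot> \<eta> A = Ident C (L A) \<cdot> \<eta> A"
      using Farr(2)[OF A A iA] Comp_Ident_left[OF \<eta>[OF A]] Comp_Ident_right[OF \<eta>[OF A]] by simp
  qed
  have comp: "Farr F (g \<cdot> f) = Farr F g \<cdot> Farr F f"
    if "X \<in> S" "Y \<in> S" "Z \<in> S" and f: "f \<in> Hom C X Y" and g: "g \<in> Hom C Y Z" for X Y Z f g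
  proof (rule cancel[OF \<open>X \<in> S\<close> L[OF \<open>Z \<in> S\<close>]])
    note FX = Farr[OF \<open>X \<in> S\<close> \<open>Y \<in> S\<close> f] and FY = Farr[OF \<open>Y \<in> S\<close> \<open>Z \<in> S\<close> g]
      and FZ = Farr[OF \<open>X \<in> S\<close> \<open>Z \<in> S\<close> Comp_Hom[OF f g]]
    show "Farr F (g \<cdot> f) \<in> Hom C (L X) (L Z)" using FZ by simp
    show "Farr F g \<cdot> Farr F f \<in> Hom C (L X) (L Z)" using FX FY by (auto intro: Comp_Hom)
    show "Farr F (g \<cdot> f) \<cdot> \<eta> X = Farr F g \<cdot> Farr F f \<cdot> \<eta> X"
      using FX FY FZ Comp_assoc[OF \<eta>[OF \<open>X \<in> S\<close>] FX(1) FY(1)]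
        Comp_assoc[OF f \<eta>[OF \<open>Y \<in> S\<close>] FY(1)] Comp_assoc[OF f g \<eta>[OF \<open>Z \<in> S\<close>]] by simp
  qed
  note full = full_subcategory_full_subcat[OF C sub]
  have FF: "is_functor (full_subcat C S) (full_subcat C S') F"
    using C sub category_full_subcat[of C S] category_full_subcat[of C S'] L Farr(1) id comp
    by (auto simp: is_functor_def Hom_full_subcat F_def[THEN arg_cong, of Fobj] split: if_splits)
  define \<Phi> where "\<Phi> = (\<lambda>A (B::'o) h. h \<cdot> \<eta> A)"
  have bij: "bij_betw (\<Phi> A B) (Hom C (L A) B) (Hom C A B)" if A: "A \<in> S" and B: "B \<in> S'" for A B
    unfolding bij_betw_def
  proof
    show "inj_on (\<Phi> A B) (Hom C (L A) B)"
      using cancel[OF A B] by (auto simp: inj_on_def \<Phi>_def)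
    show "\<Phi> A B ` Hom C (L A) B = Hom C A B"
      using Comp_Hom[OF \<eta>[OF A]] lift[OF A B] by (force simp: \<Phi>_def)
  qed
  have nat: "\<Phi> A' B' (b \<cdot> h \<cdot> Farr F a) = b \<cdot> \<Phi> A B h \<cdot> a"
    if A: "A \<in> S" "A' \<in> S" and a: "a \<in> Hom C A' A" and b: "b \<in> Hom C B B'"
      and h: "h \<in> Hom C (L A) B" for A A' B B' a b h
    using Farr[OF A(2,1) a] Comp_assoc[OF \<eta>[OF A(2)] Farr(1)[OF A(2,1) a] Comp_Hom[OF h b]]
      Comp_assoc[OF a \<eta>[OF A(1)] Comp_Hom[OF h b]] Comp_assoc[OF \<eta>[OF A(1)] h b]
    by (simp add: \<Phi>_def)
  have "left_adjoint (full_subcat C S) (full_subcat C S') F inclusion"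
    unfolding left_adjoint_def
  proof (intro conjI exI[of _ \<Phi>] ballI)
    show "is_functor (full_subcat C S') (full_subcat C S) inclusion"
      using full by (rule is_functor_inclusion)
  next
    fix A B assume "A \<in> Obj (full_subcat C S)" "B \<in> Obj (full_subcat C S')"
    then show "bij_betw (\<Phi> A B) (Hom (full_subcat C S') (Fobj F A) B)
        (Hom (full_subcat C S) A (Fobj inclusion B))"
      using bij[of A B] L sub by (auto simp: Hom_full_subcat F_def inclusion_def subset_iff)
  qed (use FF nat in \<open>auto simp: Hom_full_subcat F_def[THEN arg_cong, of Fobj] inclusion_def split: if_splits\<close>)
  then show ?thesis
    using full by (auto simp: reflective_subcategory_def)
qed

section \<open>Calculating with products and zero morphisms\<close>

locale pointed_category_with_products = category C
  for C :: "('o, 'm) cat" (structure) +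
  assumes pointed: "pointed C"
    and products: "has_binary_products C"
begin

abbreviation id_arr ("\<I>") where "id_arr \<equiv> Ident C"
abbreviation zero ("\<zero>") where "zero \<equiv> zero_arr C"
abbreviation product (infixr "\<boxtimes>" 75) where "product \<equiv> prod_obj C"
abbreviation pr1 ("\<pi>\<^sub>1") where "pr1 \<equiv> proj1 C"
abbreviation pr2 ("\<pi>\<^sub>2") where "pr2 \<equiv> proj2 C"
abbreviation pairing ("\<langle>_, _\<rangle>") where "pairing \<equiv> pair_arr C"

lemma HomD:
  assumes "f \<in> Hom C A B"
  shows "f \<in> Arr C" "Dom C f = A" "Cod C f = B"
  using assms by (simp_all add: Hom_def)

text \<open>The rules below are stated with \<open>Dom\<close> and \<open>Cod\<close> instead of \<open>Hom\<close>, because then their side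
  conditions contain no object that the simplifier would have to guess. Together they bring
  composites to a normal form: associated to the right, with composition distributed
  over pairings and zero morphisms absorbing their neighbours.\<close>

lemma obj_simps [simp]: "f \<in> Arr C \<Longrightarrow> Dom C f \<in> Obj C" "f \<in> Arr C \<Longrightarrow> Cod C f \<in> Obj C"
  by (simp_all add: Dom_Obj Cod_Obj)

lemma ident_simps [simp]:
  assumes "A \<in> Obj C"
  shows "\<I> A \<in> Arr C" "Dom C (\<I> A) = A" "Cod C (\<I> A) = A"
  using Ident_Hom[OF assms] by (simp_all add: Hom_def)

lemma comp_simps [simp]:
  assumes "f \<in> Arr C" "g \<in> Arr C" "Dom C g = Cod C f"
  shows "g \<cdot> f \<in> Arr C" "Dom C (g \<cdot> f) = Dom C f" "Cod C (g \<cdot> f) = Cod C g"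
  using Comp_Hom[of f "Dom C f" "Cod C f" g "Cod C g"] assms by (simp_all add: Hom_def)

lemma comp_ident [simp]:
  "f \<in> Arr C \<Longrightarrow> A = Dom C f \<Longrightarrow> f \<cdot> \<I> A = f"
  "f \<in> Arr C \<Longrightarrow> B = Cod C f \<Longrightarrow> \<I> B \<cdot> f = f"
  using Comp_Ident_right[of f "Dom C f" "Cod C f"] Comp_Ident_left[of f "Dom C f" "Cod C f"]
  by (simp_all add: Hom_def)

lemma assoc [simp]:
  assumes "f \<in> Arr C" "g \<in> Arr C" "h \<in> Arr C" "Dom C g = Cod C f" "Dom C h = Cod C g"
  shows "h \<cdot> g \<cdot> f = h \<cdot> (g \<cdot> f)"
  using Comp_assoc[of f "Dom C f" "Cod C f" g "Cod C g" h "Cod C h"] assms by (simp add: Hom_def)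

lemma zero_object_Hom_ex1:
  "zero_object C Z \<Longrightarrow> A \<in> Obj C \<Longrightarrow> \<exists>!f. f \<in> Hom C A Z"
  "zero_object C Z \<Longrightarrow> A \<in> Obj C \<Longrightarrow> \<exists>!f. f \<in> Hom C Z A"
  by (auto simp: zero_object_def)

text \<open>The comparison morphism between two zero objects carries one factorisation to the other, so any
  factorisation through any zero object computes the zero morphism.\<close>

lemma zero_arr_eqI:
  assumes Z: "zero_object C Z" and f: "f \<in> Hom C A Z" and g: "g \<in> Hom C Z B"
  shows "\<zero> A B = g \<cdot> f"
  unfolding zero_arr_def
proof (rule the_equality)
  show "\<exists>Z. zero_object C Z \<and> (\<exists>f'\<in>Hom C A Z. \<exists>g'\<in>Hom C Z B. g \<cdot> f = g' \<cdot> f')"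
    using assms by blast
  fix h assume "\<exists>Z. zero_object C Z \<and> (\<exists>f\<in>Hom C A Z. \<exists>g\<in>Hom C Z B. h = g \<cdot> f)"
  then obtain Z' f' g' where Z': "zero_object C Z'" and f': "f' \<in> Hom C A Z'"
    and g': "g' \<in> Hom C Z' B" and h: "h = g' \<cdot> f'" by blast
  have "Z' \<in> Obj C" "A \<in> Obj C" "B \<in> Obj C"
    using Z' f g by (auto simp: zero_object_def Hom_def)
  then obtain t where t: "t \<in> Hom C Z Z'"
    using zero_object_Hom_ex1(1)[OF Z', of Z] Z by (auto simp: zero_object_def)
  have "t \<cdot> f = f'"
    using zero_object_Hom_ex1(1)[OF Z' \<open>A \<in> Obj C\<close>] Comp_Hom[OF f t] f' by blast
  moreover have "g' \<cdot> t = g"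
    using zero_object_Hom_ex1(2)[OF Z \<open>B \<in> Obj C\<close>] Comp_Hom[OF t g'] g by blast
  ultimately show "h = g \<cdot> f"
    using h Comp_assoc[OF f t g'] by simp
qed

lemma zero_factor:
  assumes "A \<in> Obj C" "B \<in> Obj C"
  obtains Z f g where "zero_object C Z" "f \<in> Hom C A Z" "g \<in> Hom C Z B" "\<zero> A B = g \<cdot> f"
proof -
  obtain Z where Z: "zero_object C Z" using pointed by (auto simp: pointed_def)
  with assms show thesis using zero_object_Hom_ex1[OF Z] zero_arr_eqI[OF Z] that by metis
qed

lemma zero_simps [simp]:
  assumes "A \<in> Obj C" "B \<in> Obj C"
  shows "\<zero> A B \<in> Arr C" "Dom C (\<zero> A B) = A" "Cod C (\<zero> A B) = B"
proof -
  obtain Z f g where "zero_object C Z" "f \<in> Hom C A Z" "g \<in> Hom C Z B" "\<zero> A B = g \<cdot> f"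
    using zero_factor[OF assms] .
  then show "\<zero> A B \<in> Arr C" "Dom C (\<zero> A B) = A" "Cod C (\<zero> A B) = B"
    using Comp_Hom[of f A Z g B] by (auto dest: HomD)
qed

lemma comp_zero [simp]:
  assumes "A \<in> Obj C" "f \<in> Arr C" "B = Dom C f"
  shows "f \<cdot> \<zero> A B = \<zero> A (Cod C f)"
proof -
  have "B \<in> Obj C" using assms by simp
  then obtain Z a b where Z: "zero_object C Z" "a \<in> Hom C A Z" "b \<in> Hom C Z B" "\<zero> A B = b \<cdot> a"
    using zero_factor[OF assms(1)] by metis
  have f: "f \<in> Hom C B (Cod C f)" using assms by (simp add: Hom_def)
  show ?thesis using zero_arr_eqI[OF Z(1,2) Comp_Hom[OF Z(3) f]] Comp_assoc[OF Z(2,3) f] Z(4) by simp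
qed

lemma zero_comp [simp]:
  assumes "B \<in> Obj C" "f \<in> Arr C" "A = Cod C f"
  shows "\<zero> A B \<cdot> f = \<zero> (Dom C f) B"
proof -
  have "A \<in> Obj C" using assms by simp
  then obtain Z a b where Z: "zero_object C Z" "a \<in> Hom C A Z" "b \<in> Hom C Z B" "\<zero> A B = b \<cdot> a"
    using zero_factor[OF _ assms(1)] by metis
  have f: "f \<in> Hom C (Dom C f) A" using assms by (simp add: Hom_def)
  show ?thesis using zero_arr_eqI[OF Z(1) Comp_Hom[OF f Z(2)] Z(3)] Comp_assoc[OF f Z(2,3)] Z(4) by simp
qed

lemma is_product_chosen:
  assumes "A \<in> Obj C" "B \<in> Obj C"
  shows "is_product C A B (A \<boxtimes> B) (\<pi>\<^sub>1 A B) (\<pi>\<^sub>2 A B)"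
proof -
  have "\<exists>x. case x of (P, p, q) \<Rightarrow> is_product C A B P p q"
    using products assms by (auto simp: has_binary_products_def)
  then have "case product_cone C A B of (P, p, q) \<Rightarrow> is_product C A B P p q"
    unfolding product_cone_def by (rule someI_ex)
  then show ?thesis
    by (simp add: prod_obj_def proj1_def proj2_def split: prod.splits)
qed

lemma product_simps [simp]:
  assumes "A \<in> Obj C" "B \<in> Obj C"
  shows "A \<boxtimes> B \<in> Obj C"
    "\<pi>\<^sub>1 A B \<in> Arr C" "Dom C (\<pi>\<^sub>1 A B) = A \<boxtimes> B" "Cod C (\<pi>\<^sub>1 A B) = A"
    "\<pi>\<^sub>2 A B \<in> Arr C" "Dom C (\<pi>\<^sub>2 A B) = A \<boxtimes> B" "Cod C (\<pi>\<^sub>2 A B) = B"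
  using is_product_chosen[OF assms] by (auto simp: is_product_def Hom_def)

lemma pair_ex1:
  assumes "f \<in> Arr C" "g \<in> Arr C" "Dom C f = Dom C g"
  shows "\<exists>!h. h \<in> Hom C (Dom C f) (Cod C f \<boxtimes> Cod C g) \<and>
    \<pi>\<^sub>1 (Cod C f) (Cod C g) \<cdot> h = f \<and> \<pi>\<^sub>2 (Cod C f) (Cod C g) \<cdot> h = g"
proof -
  have "f \<in> Hom C (Dom C f) (Cod C f)" "g \<in> Hom C (Dom C f) (Cod C g)"
    "Dom C f \<in> Obj C" "Cod C f \<in> Obj C" "Cod C g \<in> Obj C"
    using assms by (auto simp: Hom_def)
  then show ?thesis using is_product_chosen[of "Cod C f" "Cod C g"] by (auto simp: is_product_def)
qed

lemma pair_simps [simp]: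
  assumes "f \<in> Arr C" "g \<in> Arr C" "Dom C f = Dom C g"
  shows "\<langle>f, g\<rangle> \<in> Arr C" "Dom C \<langle>f, g\<rangle> = Dom C g" "Cod C \<langle>f, g\<rangle> = Cod C f \<boxtimes> Cod C g"
  using theI'[OF pair_ex1[OF assms], folded pair_arr_def] assms by (auto simp: Hom_def)

lemma proj_pair [simp]:
  assumes "f \<in> Arr C" "g \<in> Arr C" "Dom C f = Dom C g" "A = Cod C f" "B = Cod C g"
  shows "\<pi>\<^sub>1 A B \<cdot> \<langle>f, g\<rangle> = f" "\<pi>\<^sub>2 A B \<cdot> \<langle>f, g\<rangle> = g"
  using theI'[OF pair_ex1[OF assms(1-3)], folded pair_arr_def] assms by auto

lemma pair_unique:
  assumes "h \<in> Arr C" "Cod C h = A \<boxtimes> B" "A \<in> Obj C" "B \<in> Obj C"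
  shows "h = \<langle>\<pi>\<^sub>1 A B \<cdot> h, \<pi>\<^sub>2 A B \<cdot> h\<rangle>"
  using the1_equality[OF pair_ex1[of "\<pi>\<^sub>1 A B \<cdot> h" "\<pi>\<^sub>2 A B \<cdot> h"], folded pair_arr_def, of h] assms
  by (simp add: Hom_def)

lemma proj_pair_comp [simp]:
  assumes "f \<in> Arr C" "g \<in> Arr C" "k \<in> Arr C" "Dom C f = Dom C g" "Dom C g = Cod C k"
    "A = Cod C f" "B = Cod C g"
  shows "\<pi>\<^sub>1 A B \<cdot> (\<langle>f, g\<rangle> \<cdot> k) = f \<cdot> k" "\<pi>\<^sub>2 A B \<cdot> (\<langle>f, g\<rangle> \<cdot> k) = g \<cdot> k"
  using assms by (simp_all flip: assoc)

lemma pair_comp [simp]: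
  assumes "f \<in> Arr C" "g \<in> Arr C" "k \<in> Arr C" "Dom C f = Dom C g" "Dom C g = Cod C k"
  shows "\<langle>f, g\<rangle> \<cdot> k = \<langle>f \<cdot> k, g \<cdot> k\<rangle>"
  using pair_unique[of "\<langle>f, g\<rangle> \<cdot> k" "Cod C f" "Cod C g"] assms by simp

lemma pair_proj [simp]:
  assumes "A \<in> Obj C" "B \<in> Obj C"
  shows "\<langle>\<pi>\<^sub>1 A B, \<pi>\<^sub>2 A B\<rangle> = \<I> (A \<boxtimes> B)"
  using pair_unique[of "\<I> (A \<boxtimes> B)" A B] assms by simp

lemma pair_zero [simp]:
  assumes "A \<in> Obj C" "B \<in> Obj C" "D \<in> Obj C"
  shows "\<langle>\<zero> D A, \<zero> D B\<rangle> = \<zero> D (A \<boxtimes> B)"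
  using pair_unique[of "\<zero> D (A \<boxtimes> B)" A B] assms by simp

lemma coequaliserD:
  assumes "is_coequaliser C u v q"
  shows "u \<in> Arr C" "v \<in> Arr C" "Dom C v = Dom C u" "Cod C v = Cod C u"
    "q \<in> Arr C" "Dom C q = Cod C u" "q \<cdot> u = q \<cdot> v"
  using assms by (auto simp: is_coequaliser_def Hom_def)

lemma coequaliser_factor:
  assumes "is_coequaliser C u v q" "h \<in> Arr C" "Dom C h = Cod C u" "h \<cdot> u = h \<cdot> v"
  obtains k where "k \<in> Arr C" "Dom C k = Cod C q" "Cod C k = Cod C h" "k \<cdot> q = h"
  using assms unfolding is_coequaliser_def Hom_def by blast

lemma coequaliser_epi:
  assumes q: "is_coequaliser C u v q" and k: "k \<in> Arr C" "Dom C k = Cod C q"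
    and k': "k' \<in> Arr C" "Dom C k' = Cod C q" "Cod C k' = Cod C k" and eq: "k \<cdot> q = k' \<cdot> q"
  shows "k = k'"
proof -
  note qD = coequaliserD[OF q]
  have "k \<cdot> q \<cdot> u = k \<cdot> q \<cdot> v" using qD k by simp
  then have "\<exists>!l. l \<in> Hom C (Cod C q) (Cod C (k \<cdot> q)) \<and> l \<cdot> q = k \<cdot> q"
    using q k qD unfolding is_coequaliser_def by (metis comp_simps(1,2))
  then show ?thesis using k k' eq qD by (auto simp: Hom_def)
qed

lemma is_cooperator_iff:
  "is_cooperator C f g \<rho> \<longleftrightarrow> f \<in> Arr C \<and> g \<in> Arr C \<and> Cod C g = Cod C f \<and>
     \<rho> \<in> Arr C \<and> Dom C \<rho> = Dom C f \<boxtimes> Dom C g \<and> Cod C \<rho> = Cod C f \<and>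
     \<rho> \<cdot> \<langle>\<I> (Dom C f), \<zero> (Dom C f) (Dom C g)\<rangle> = f \<and>
     \<rho> \<cdot> \<langle>\<zero> (Dom C g) (Dom C f), \<I> (Dom C g)\<rangle> = g"
  by (auto simp: is_cooperator_def inj1_def inj2_def Hom_def)

end

section \<open>Cooperators are unique\<close>

locale products_commuting_with_coequalisers = pointed_category_with_products +
  assumes coequalisers: "has_coequalisers C"
    and commuting: "products_commute_with_coequalisers C"
begin

lemma coequaliser_ex:
  assumes "u \<in> Arr C" "v \<in> Arr C" "Dom C u = Dom C v" "Cod C u = Cod C v"
  obtains q where "is_coequaliser C u v q"
  using coequalisers assms unfolding has_coequalisers_def Hom_def by blast

lemma coequaliser_prod:
  assumes "is_coequaliser C u v q" "is_coequaliser C u' v' q'"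
  shows "is_coequaliser C (prod_arr C u u') (prod_arr C v v') (prod_arr C q q')"
  using commuting assms unfolding products_commute_with_coequalisers_def by blast

text \<open>The identity of \<open>E\<close> is thereby a coequaliser of a morphism \<open>0 \<rightarrow> E\<close> with itself, and not only of
  the identity with itself: this freedom is what \<open>coequalise_slice\<close> exploits.\<close>

lemma coequaliser_ident:
  assumes "u \<in> Arr C" "A = Cod C u"
  shows "is_coequaliser C u u (\<I> A)"
  unfolding is_coequaliser_def using assms by (auto simp: Hom_def)

text \<open>Let \<open>q\<close> be the coequaliser of \<open>u\<close> and \<open>v\<close>. Multiplied by the identity of \<open>E\<close>, as a coequaliser of
  the zero morphism with itself, it yields that \<open>q \<times> 1\<close> is a coequaliser of \<open>u \<times> 0\<close> and \<open>v \<times> 0\<close>. These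
  two only see the slice \<open>B \<times> 0\<close>, so the hypothesis on \<open>h\<close> suffices for \<open>h\<close> to factor
  through \<open>q \<times> 1\<close>, which does identify \<open>u \<times> 1\<close> with \<open>v \<times> 1\<close>. The zero morphism is taken from \<open>A\<close>, so that
  no zero object has to be chosen.\<close>

lemma coequalise_slice:
  assumes uv: "u \<in> Arr C" "v \<in> Arr C" "Dom C u = A" "Dom C v = A" "Cod C u = B" "Cod C v = B"
    and E: "E \<in> Obj C"
    and h: "h \<in> Arr C" "Dom C h = B \<boxtimes> E"
    and eq: "h \<cdot> \<langle>u, \<zero> A E\<rangle> = h \<cdot> \<langle>v, \<zero> A E\<rangle>"
  shows "h \<cdot> \<langle>u \<cdot> \<pi>\<^sub>1 A E, \<pi>\<^sub>2 A E\<rangle> = h \<cdot> \<langle>v \<cdot> \<pi>\<^sub>1 A E, \<pi>\<^sub>2 A E\<rangle>"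
proof -
  have obj: "A \<in> Obj C" "B \<in> Obj C" using uv by auto
  obtain q where q: "is_coequaliser C u v q" using coequaliser_ex uv by metis
  note qD = coequaliserD[OF q]
  have cq: "is_coequaliser C (prod_arr C u (\<zero> A E)) (prod_arr C v (\<zero> A E)) (prod_arr C q (\<I> E))"
    using coequaliser_prod[OF q coequaliser_ident[of "\<zero> A E" E]] obj E by simp
  have factor: "prod_arr C w (\<zero> A E) = \<langle>w, \<zero> A E\<rangle> \<cdot> \<pi>\<^sub>1 A A"
    if "w \<in> Arr C" "Dom C w = A" for w
    using that obj E by (simp add: prod_arr_def)
  have "h \<cdot> prod_arr C u (\<zero> A E) = (h \<cdot> \<langle>u, \<zero> A E\<rangle>) \<cdot> \<pi>\<^sub>1 A A"
    using uv h obj E by (simp add: factor del: pair_comp)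
  also have "\<dots> = h \<cdot> prod_arr C v (\<zero> A E)"
    using uv h obj E by (simp add: factor eq del: pair_comp)
  finally have "h \<cdot> prod_arr C u (\<zero> A E) = h \<cdot> prod_arr C v (\<zero> A E)" .
  then obtain k where k: "k \<in> Arr C" "Dom C k = Cod C q \<boxtimes> E" "k \<cdot> prod_arr C q (\<I> E) = h"
    using coequaliser_factor[OF cq h(1)] uv h obj E qD by (auto simp: prod_arr_def)
  then have "h = k \<cdot> \<langle>q \<cdot> \<pi>\<^sub>1 B E, \<pi>\<^sub>2 B E\<rangle>"
    using uv qD E obj by (simp add: prod_arr_def)
  moreover have "q \<cdot> (u \<cdot> \<pi>\<^sub>1 A E) = q \<cdot> (v \<cdot> \<pi>\<^sub>1 A E)"
    using qD uv obj E by (simp flip: assoc)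
  ultimately show ?thesis
    using uv qD E obj k by simp
qed


lemma cooperator_comp_left:
  assumes "is_cooperator C f g \<rho>" "a \<in> Arr C" "Cod C a = Dom C f" "A = Dom C a" "B = Dom C g"
  shows "\<rho> \<cdot> \<langle>a, \<zero> A B\<rangle> = f \<cdot> a"
proof -
  have \<rho>: "f \<in> Arr C" "g \<in> Arr C" "\<rho> \<in> Arr C" "Dom C \<rho> = Dom C f \<boxtimes> Dom C g"
    "\<rho> \<cdot> \<langle>\<I> (Dom C f), \<zero> (Dom C f) (Dom C g)\<rangle> = f"
    using assms(1) unfolding is_cooperator_iff by blast+
  then have "f \<cdot> a = \<rho> \<cdot> \<langle>\<I> (Dom C f), \<zero> (Dom C f) (Dom C g)\<rangle> \<cdot> a"
    by (simp only: \<rho>(5))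
  also have "\<dots> = \<rho> \<cdot> \<langle>a, \<zero> A B\<rangle>"
    using assms(2-) \<rho>(1-4) by simp
  finally show ?thesis by simp
qed

lemma cooperator_comp_right:
  assumes "is_cooperator C f g \<rho>" "b \<in> Arr C" "Cod C b = Dom C g" "B = Dom C b" "A = Dom C f"
  shows "\<rho> \<cdot> \<langle>\<zero> B A, b\<rangle> = g \<cdot> b"
proof -
  have \<rho>: "f \<in> Arr C" "g \<in> Arr C" "\<rho> \<in> Arr C" "Dom C \<rho> = Dom C f \<boxtimes> Dom C g"
    "\<rho> \<cdot> \<langle>\<zero> (Dom C g) (Dom C f), \<I> (Dom C g)\<rangle> = g"
    using assms(1) unfolding is_cooperator_iff by blast+
  then have "g \<cdot> b = \<rho> \<cdot> \<langle>\<zero> (Dom C g) (Dom C f), \<I> (Dom C g)\<rangle> \<cdot> b"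
    by (simp only: \<rho>(5))
  also have "\<dots> = \<rho> \<cdot> \<langle>\<zero> B A, b\<rangle>"
    using assms(2-) \<rho>(1-4) by simp
  finally show ?thesis by simp
qed

text \<open>With \<open>c\<close> written as addition, consider \<open>(x, y, z) \<mapsto> x + \<rho> (y, z)\<close> on \<open>X \<times> X \<times> X'\<close>. At \<open>(x, 0, 0)\<close> and
  at \<open>(0, x, 0)\<close> it takes the same value \<open>f x\<close>, so by \<open>coequalise_slice\<close> it also agrees at
  \<open>(x, 0, z)\<close> and \<open>(0, x, z)\<close>, where its values are \<open>x + g z\<close> and \<open>\<rho> (x, z)\<close>.\<close>

theorem cooperator_eq:
  assumes c: "is_cooperator C f (\<I> (Cod C f)) c" and \<rho>: "is_cooperator C f g \<rho>"
  shows "\<rho> = c \<cdot> \<langle>\<pi>\<^sub>1 (Dom C f) (Dom C g), g \<cdot> \<pi>\<^sub>2 (Dom C f) (Dom C g)\<rangle>"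
proof -
  define X X' Y where "X = Dom C f" and "X' = Dom C g" and "Y = Cod C f"
  have f: "f \<in> Arr C" "Dom C f = X" "Cod C f = Y" and g: "g \<in> Arr C" "Dom C g = X'" "Cod C g = Y"
    using \<rho> by (simp_all add: is_cooperator_iff X_def X'_def Y_def)
  then have obj: "X \<in> Obj C" "X' \<in> Obj C" "Y \<in> Obj C" by auto
  have cA: "c \<in> Arr C" "Dom C c = X \<boxtimes> Y" "Cod C c = Y"
    and rA: "\<rho> \<in> Arr C" "Dom C \<rho> = X \<boxtimes> X'" "Cod C \<rho> = Y"
    using c \<rho> f g obj by (simp_all add: is_cooperator_iff)
  note simps = f g obj cA rA cooperator_comp_left[OF c] cooperator_comp_right[OF c]
    cooperator_comp_left[OF \<rho>] cooperator_comp_right[OF \<rho>]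
  define h where "h = c \<cdot> \<langle>\<pi>\<^sub>1 X X \<cdot> \<pi>\<^sub>1 (X \<boxtimes> X) X', \<rho> \<cdot> \<langle>\<pi>\<^sub>2 X X \<cdot> \<pi>\<^sub>1 (X \<boxtimes> X) X', \<pi>\<^sub>2 (X \<boxtimes> X) X'\<rangle>\<rangle>"
  define u v where "u = \<langle>\<I> X, \<zero> X X\<rangle>" and "v = \<langle>\<zero> X X, \<I> X\<rangle>"
  have h: "h \<in> Arr C" "Dom C h = (X \<boxtimes> X) \<boxtimes> X'" by (simp_all add: h_def simps)
  have u: "u \<in> Arr C" "Dom C u = X" "Cod C u = X \<boxtimes> X"
    and v: "v \<in> Arr C" "Dom C v = X" "Cod C v = X \<boxtimes> X"
    by (simp_all add: u_def v_def simps)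
  have "h \<cdot> \<langle>u, \<zero> X X'\<rangle> = f" by (simp add: h_def u_def simps)
  moreover have "h \<cdot> \<langle>v, \<zero> X X'\<rangle> = f" by (simp add: h_def v_def simps)
  ultimately have "h \<cdot> \<langle>u \<cdot> \<pi>\<^sub>1 X X', \<pi>\<^sub>2 X X'\<rangle> = h \<cdot> \<langle>v \<cdot> \<pi>\<^sub>1 X X', \<pi>\<^sub>2 X X'\<rangle>"
    using coequalise_slice[OF u(1) v(1) u(2) v(2) u(3) v(3) obj(2) h] by simp
  moreover have "h \<cdot> \<langle>u \<cdot> \<pi>\<^sub>1 X X', \<pi>\<^sub>2 X X'\<rangle> = c \<cdot> \<langle>\<pi>\<^sub>1 X X', g \<cdot> \<pi>\<^sub>2 X X'\<rangle>"
    by (simp add: h_def u_def simps)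
  moreover have "h \<cdot> \<langle>v \<cdot> \<pi>\<^sub>1 X X', \<pi>\<^sub>2 X X'\<rangle> = \<rho>"
    by (simp add: h_def v_def simps)
  ultimately show ?thesis by (simp add: f g)
qed

lemma central_cooperator_unique:
  assumes "central C f" "is_cooperator C f g \<rho>" "is_cooperator C f g \<rho>'"
  shows "\<rho> = \<rho>'"
  using assms cooperator_eq unfolding central_def commute_def by metis

section \<open>The addition on a commutative object\<close>

abbreviation is_addition where "is_addition X m \<equiv> is_cooperator C (\<I> X) (\<I> X) m"

lemma commutative_object_iff: "commutative_object C X \<longleftrightarrow> X \<in> Obj C \<and> (\<exists>m. is_addition X m)"
  by (auto simp: commutative_object_def central_def commute_def)

context
  fixes X m
  assumes X [simp]: "X \<in> Obj C" and m: "is_addition X m"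
begin

lemma addition_simps [simp]: "m \<in> Arr C" "Dom C m = X \<boxtimes> X" "Cod C m = X"
  using m by (auto simp: is_cooperator_iff)

lemma addition_zero [simp]:
  assumes "a \<in> Arr C" "Cod C a = X" "A = Dom C a"
  shows "m \<cdot> \<langle>a, \<zero> A X\<rangle> = a" "m \<cdot> \<langle>\<zero> A X, a\<rangle> = a"
  using assms cooperator_comp_left[OF m, of a] cooperator_comp_right[OF m, of a] by simp_all

lemma sum_is_cooperator:
  assumes "f \<in> Arr C" "Cod C f = X" "g \<in> Arr C" "Cod C g = X"
  shows "is_cooperator C f g (m \<cdot> \<langle>f \<cdot> \<pi>\<^sub>1 (Dom C f) (Dom C g), g \<cdot> \<pi>\<^sub>2 (Dom C f) (Dom C g)\<rangle>)"
  using assms by (simp add: is_cooperator_iff)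

lemma central_into_commutative: "f \<in> Arr C \<Longrightarrow> Cod C f = X \<Longrightarrow> central C f"
  using sum_is_cooperator[of f "\<I> X"] by (auto simp: central_def commute_def)

lemma cooperator_into_commutative:
  assumes "is_cooperator C f g \<rho>" "Cod C f = X"
  shows "\<rho> = m \<cdot> \<langle>f \<cdot> \<pi>\<^sub>1 (Dom C f) (Dom C g), g \<cdot> \<pi>\<^sub>2 (Dom C f) (Dom C g)\<rangle>"
  using assms central_cooperator_unique[OF central_into_commutative assms(1)] sum_is_cooperator[of f g]
  by (auto simp: is_cooperator_iff)

text \<open>Uniqueness of cooperators in its most useful form: a morphism into a commutative object is the
  sum of its restrictions to the two axes. The laws of the addition follow by evaluating both
  sides on the axes.\<close>

lemma arr_from_product_eq:
  assumes "h \<in> Arr C" "Dom C h = A \<boxtimes> B" "Cod C h = X" "A \<in> Obj C" "B \<in> Obj C"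
  shows "h = m \<cdot> \<langle>h \<cdot> \<langle>\<I> A, \<zero> A B\<rangle> \<cdot> \<pi>\<^sub>1 A B, h \<cdot> \<langle>\<zero> B A, \<I> B\<rangle> \<cdot> \<pi>\<^sub>2 A B\<rangle>"
  using cooperator_into_commutative[of "h \<cdot> \<langle>\<I> A, \<zero> A B\<rangle>" "h \<cdot> \<langle>\<zero> B A, \<I> B\<rangle>" h] assms
  by (simp add: is_cooperator_iff)

lemma addition_commute:
  assumes "a \<in> Arr C" "b \<in> Arr C" "Dom C a = Dom C b" "Cod C a = X" "Cod C b = X"
  shows "m \<cdot> \<langle>a, b\<rangle> = m \<cdot> \<langle>b, a\<rangle>"
proof -
  have "m \<cdot> \<langle>\<pi>\<^sub>2 X X, \<pi>\<^sub>1 X X\<rangle> = m"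
    using arr_from_product_eq[of "m \<cdot> \<langle>\<pi>\<^sub>2 X X, \<pi>\<^sub>1 X X\<rangle>" X X] by simp
  then have "m \<cdot> \<langle>a, b\<rangle> = m \<cdot> \<langle>\<pi>\<^sub>2 X X, \<pi>\<^sub>1 X X\<rangle> \<cdot> \<langle>a, b\<rangle>" by simp
  then show ?thesis using assms by simp
qed

lemma addition_assoc:
  assumes "a \<in> Arr C" "b \<in> Arr C" "c \<in> Arr C" "Dom C a = Dom C b" "Dom C b = Dom C c"
    "Cod C a = X" "Cod C b = X" "Cod C c = X"
  shows "m \<cdot> \<langle>m \<cdot> \<langle>a, b\<rangle>, c\<rangle> = m \<cdot> \<langle>a, m \<cdot> \<langle>b, c\<rangle>\<rangle>"
proof -
  define P where "P = X \<boxtimes> X"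
  have P [simp]: "P \<in> Obj C" "X \<boxtimes> X = P" by (simp_all add: P_def)
  \<comment> \<open>The map \<open>((a, b), c) \<mapsto> a + (b + c)\<close>, whose restrictions to the axes are \<open>m\<close> and the identity.\<close>
  define r where "r = m \<cdot> \<langle>\<pi>\<^sub>1 X X \<cdot> \<pi>\<^sub>1 P X, m \<cdot> \<langle>\<pi>\<^sub>2 X X \<cdot> \<pi>\<^sub>1 P X, \<pi>\<^sub>2 P X\<rangle>\<rangle>"
  have r: "r \<in> Arr C" "Dom C r = P \<boxtimes> X" "Cod C r = X"
    by (simp_all add: r_def)
  have "r = m \<cdot> \<langle>m \<cdot> \<pi>\<^sub>1 P X, \<pi>\<^sub>2 P X\<rangle>"
    using arr_from_product_eq[of r P X] by (simp add: r_def)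
  then have "m \<cdot> \<langle>m \<cdot> \<pi>\<^sub>1 P X, \<pi>\<^sub>2 P X\<rangle> \<cdot> \<langle>\<langle>a, b\<rangle>, c\<rangle> = r \<cdot> \<langle>\<langle>a, b\<rangle>, c\<rangle>" by simp
  then show ?thesis using assms by (simp add: r_def)
qed

lemma addition_inverse_unique:
  assumes "a \<in> Arr C" "b \<in> Arr C" "c \<in> Arr C" "Dom C a = A" "Dom C b = A" "Dom C c = A"
    "Cod C a = X" "Cod C b = X" "Cod C c = X"
    and "m \<cdot> \<langle>a, b\<rangle> = \<zero> A X" "m \<cdot> \<langle>a, c\<rangle> = \<zero> A X"
  shows "b = c"
proof -
  have "b = m \<cdot> \<langle>b, m \<cdot> \<langle>a, c\<rangle>\<rangle>" using assms by simp
  also have "\<dots> = m \<cdot> \<langle>m \<cdot> \<langle>b, a\<rangle>, c\<rangle>" using assms by (simp only: addition_assoc)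
  also have "m \<cdot> \<langle>b, a\<rangle> = \<zero> A X" using assms addition_commute[of b a] by simp
  also have "m \<cdot> \<langle>\<zero> A X, c\<rangle> = c" using assms by simp
  finally show ?thesis .
qed

lemma mult_central_monoid:
  assumes "x \<in> Arr C" "y \<in> Arr C" "Dom C x = A" "Dom C y = A" "Cod C x = X" "Cod C y = X"
  shows "monoid.mult (central_monoid C A X) x y = m \<cdot> \<langle>x, y\<rangle>"
proof -
  have "A \<in> Obj C" using assms by auto
  moreover have "cooperator C x y = m \<cdot> \<langle>x \<cdot> \<pi>\<^sub>1 A A, y \<cdot> \<pi>\<^sub>2 A A\<rangle>"
    unfolding cooperator_def
  proof (rule the_equality)
    show "is_cooperator C x y (m \<cdot> \<langle>x \<cdot> \<pi>\<^sub>1 A A, y \<cdot> \<pi>\<^sub>2 A A\<rangle>)"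
      using sum_is_cooperator[of x y] assms by simp
    show "\<rho> = m \<cdot> \<langle>x \<cdot> \<pi>\<^sub>1 A A, y \<cdot> \<pi>\<^sub>2 A A\<rangle>" if "is_cooperator C x y \<rho>" for \<rho>
      using cooperator_into_commutative[OF that] assms by simp
  qed
  ultimately show ?thesis
    using assms by (simp add: central_monoid_def)
qed

lemma abelian_object_iff_inverse:
  "abelian_object C X \<longleftrightarrow> (\<exists>i\<in>Hom C X X. m \<cdot> \<langle>\<I> X, i\<rangle> = \<zero> X X)"
proof -
  have carrier: "f \<in> carrier (central_monoid C X X) \<longleftrightarrow> f \<in> Hom C X X" for f
    using central_into_commutative[of f] by (auto simp: central_monoid_def Hom_def)
  have one: "monoid.one (central_monoid C X X) = \<zero> X X" by (simp add: central_monoid_def)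
  have mult: "monoid.mult (central_monoid C X X) (\<I> X) i = m \<cdot> \<langle>\<I> X, i\<rangle>"
    "monoid.mult (central_monoid C X X) i (\<I> X) = m \<cdot> \<langle>\<I> X, i\<rangle>" if "i \<in> Hom C X X" for i
    using HomD[OF that] addition_commute[of i "\<I> X"] by (simp_all add: mult_central_monoid)
  have "\<I> X \<in> Units (central_monoid C X X) \<longleftrightarrow> (\<exists>i\<in>Hom C X X. m \<cdot> \<langle>\<I> X, i\<rangle> = \<zero> X X)"
    using Ident_Hom[OF X] by (auto simp: Units_def carrier one mult)
  then show ?thesis
    using m central_into_commutative[of "\<I> X"]
    by (auto simp: abelian_object_def symmetrizable_def commutative_object_iff)
qed

end

section \<open>Group completion\<close>

text \<open>In the proof \<open>d\<close> is the diagonal of \<open>X\<close>, \<open>q\<close> its cokernel, and \<open>s\<close> the componentwise addition on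
  \<open>P = X \<times> X\<close>. The composite of \<open>s\<close> with \<open>d \<times> d\<close> is \<open>(m, m)\<close>, which lies on the diagonal and is
  killed by \<open>q\<close>; this is why \<open>s\<close> descends.\<close>

theorem group_completion:
  assumes com: "commutative_object C X"
  shows "\<exists>Q\<in>{A. abelian_object C A}. \<exists>\<eta>\<in>Hom C X Q.
    \<forall>A\<in>{A. abelian_object C A}. \<forall>h\<in>Hom C X A. \<exists>!k. k \<in> Hom C Q A \<and> k \<cdot> \<eta> = h"
proof -
  obtain m where X [simp]: "X \<in> Obj C" and m: "is_addition X m"
    using com unfolding commutative_object_iff by blast
  note [simp] = addition_simps[OF X m] addition_zero[OF X m]
  define P where "P = X \<boxtimes> X"
  define d where "d = \<langle>\<I> X, \<I> X\<rangle>"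
  have P [simp]: "P \<in> Obj C" "X \<boxtimes> X = P" by (simp_all add: P_def)
  have d [simp]: "d \<in> Arr C" "Dom C d = X" "Cod C d = P" by (simp_all add: d_def)
  obtain q where q: "is_coequaliser C d (\<zero> X P) q"
    using coequaliser_ex[of d "\<zero> X P"] by auto
  define Q where "Q = Cod C q"
  have qA [simp]: "q \<in> Arr C" "Dom C q = P" "Cod C q = Q" and qd: "q \<cdot> d = \<zero> X Q"
    using coequaliserD[OF q] by (auto simp: Q_def)
  have Q [simp]: "Q \<in> Obj C" using qA by (metis obj_simps(2))
  have diag: "q \<cdot> \<langle>a, a\<rangle> = \<zero> (Dom C a) Q" if "a \<in> Arr C" "Cod C a = X" for a
  proof -
    have "q \<cdot> \<langle>a, a\<rangle> = q \<cdot> (d \<cdot> a)" using that by (simp add: d_def)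
    also have "\<dots> = \<zero> (Dom C a) Q" using that by (simp add: qd flip: assoc)
    finally show ?thesis .
  qed
  define \<eta> where "\<eta> = q \<cdot> \<langle>\<I> X, \<zero> X X\<rangle>"
  have \<eta>: "\<eta> \<in> Hom C X Q" by (simp add: \<eta>_def Hom_def)

  have qq: "is_coequaliser C (prod_arr C d d) (prod_arr C (\<zero> X P) (\<zero> X P)) (prod_arr C q q)"
    using coequaliser_prod[OF q q] .
  define s where "s = \<langle>m \<cdot> \<langle>\<pi>\<^sub>1 X X \<cdot> \<pi>\<^sub>1 P P, \<pi>\<^sub>1 X X \<cdot> \<pi>\<^sub>2 P P\<rangle>, m \<cdot> \<langle>\<pi>\<^sub>2 X X \<cdot> \<pi>\<^sub>1 P P, \<pi>\<^sub>2 X X \<cdot> \<pi>\<^sub>2 P P\<rangle>\<rangle>"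
  have s [simp]: "s \<in> Arr C" "Dom C s = P \<boxtimes> P" "Cod C s = P" by (simp_all add: s_def)
  have "q \<cdot> s \<cdot> prod_arr C d d = q \<cdot> \<langle>m, m\<rangle>"
    by (simp add: s_def prod_arr_def d_def)
  also have "\<dots> = q \<cdot> s \<cdot> prod_arr C (\<zero> X P) (\<zero> X P)"
    by (simp add: diag prod_arr_def)
  finally have "q \<cdot> s \<cdot> prod_arr C d d = q \<cdot> s \<cdot> prod_arr C (\<zero> X P) (\<zero> X P)" .
  then obtain mQ where mQ [simp]: "mQ \<in> Arr C" "Dom C mQ = Q \<boxtimes> Q" "Cod C mQ = Q"
    and mQ_qq: "mQ \<cdot> prod_arr C q q = q \<cdot> s"
    using coequaliser_factor[OF qq, of "q \<cdot> s"] by (auto simp: prod_arr_def)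
  have mQ_q: "mQ \<cdot> \<langle>q \<cdot> a, q \<cdot> b\<rangle> = q \<cdot> (s \<cdot> \<langle>a, b\<rangle>)"
    if "a \<in> Arr C" "b \<in> Arr C" "Dom C a = Dom C b" "Cod C a = P" "Cod C b = P" for a b
  proof -
    have "mQ \<cdot> \<langle>q \<cdot> a, q \<cdot> b\<rangle> = mQ \<cdot> prod_arr C q q \<cdot> \<langle>a, b\<rangle>"
      using that by (simp add: prod_arr_def)
    then show ?thesis using that by (simp add: mQ_qq)
  qed
  have "is_addition Q mQ"
  proof -
    have "mQ \<cdot> \<langle>\<I> Q, \<zero> Q Q\<rangle> \<cdot> q = mQ \<cdot> \<langle>q \<cdot> \<I> P, q \<cdot> \<zero> P P\<rangle>" by simp
    also have "\<dots> = \<I> Q \<cdot> q" by (subst mQ_q) (simp_all add: s_def)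
    finally have 1: "mQ \<cdot> \<langle>\<I> Q, \<zero> Q Q\<rangle> = \<I> Q" by - (rule coequaliser_epi[OF q], auto)
    have "mQ \<cdot> \<langle>\<zero> Q Q, \<I> Q\<rangle> \<cdot> q = mQ \<cdot> \<langle>q \<cdot> \<zero> P P, q \<cdot> \<I> P\<rangle>" by simp
    also have "\<dots> = \<I> Q \<cdot> q" by (subst mQ_q) (simp_all add: s_def)
    finally have 2: "mQ \<cdot> \<langle>\<zero> Q Q, \<I> Q\<rangle> = \<I> Q" by - (rule coequaliser_epi[OF q], auto)
    show ?thesis unfolding is_cooperator_iff by (simp add: 1 2)
  qed
  moreover have "\<exists>i\<in>Hom C Q Q. mQ \<cdot> \<langle>\<I> Q, i\<rangle> = \<zero> Q Q"
  proof -
    \<comment> \<open>The exchange of components represents negation of formal differences.\<close>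
    define w where "w = \<langle>\<pi>\<^sub>2 X X, \<pi>\<^sub>1 X X\<rangle>"
    have w [simp]: "w \<in> Arr C" "Dom C w = P" "Cod C w = P" by (simp_all add: w_def)
    have "q \<cdot> w \<cdot> d = q \<cdot> w \<cdot> \<zero> X P" by (simp add: w_def d_def diag)
    then obtain i where i [simp]: "i \<in> Arr C" "Dom C i = Q" "Cod C i = Q" and iq: "i \<cdot> q = q \<cdot> w"
      using coequaliser_factor[OF q, of "q \<cdot> w"] by auto
    have "mQ \<cdot> \<langle>\<I> Q, i\<rangle> \<cdot> q = mQ \<cdot> \<langle>q \<cdot> \<I> P, q \<cdot> w\<rangle>" by (simp add: iq)
    also have "\<dots> = q \<cdot> \<langle>m \<cdot> \<langle>\<pi>\<^sub>1 X X, \<pi>\<^sub>2 X X\<rangle>, m \<cdot> \<langle>\<pi>\<^sub>2 X X, \<pi>\<^sub>1 X X\<rangle>\<rangle>"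
      by (subst mQ_q) (simp_all add: s_def w_def)
    also have "m \<cdot> \<langle>\<pi>\<^sub>2 X X, \<pi>\<^sub>1 X X\<rangle> = m \<cdot> \<langle>\<pi>\<^sub>1 X X, \<pi>\<^sub>2 X X\<rangle>"
      by (rule addition_commute[OF X m]) simp_all
    also have "q \<cdot> \<langle>m \<cdot> \<langle>\<pi>\<^sub>1 X X, \<pi>\<^sub>2 X X\<rangle>, m \<cdot> \<langle>\<pi>\<^sub>1 X X, \<pi>\<^sub>2 X X\<rangle>\<rangle> = \<zero> Q Q \<cdot> q"
      by (simp add: diag)
    finally have "mQ \<cdot> \<langle>\<I> Q, i\<rangle> = \<zero> Q Q" by - (rule coequaliser_epi[OF q], auto)
    then show ?thesis by (rule bexI) (simp add: Hom_def)
  qed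
  ultimately have ab: "abelian_object C Q"
    using abelian_object_iff_inverse[OF Q] by blast

  have univ: "\<exists>!k. k \<in> Hom C Q A \<and> k \<cdot> \<eta> = h" if A: "abelian_object C A" and h: "h \<in> Hom C X A" for A h
  proof -
    obtain n where A' [simp]: "A \<in> Obj C" and n: "is_addition A n"
      using A by (auto simp: abelian_object_def commutative_object_iff)
    then obtain i where i [simp]: "i \<in> Arr C" "Dom C i = A" "Cod C i = A"
      and ni: "n \<cdot> \<langle>\<I> A, i\<rangle> = \<zero> A A"
      using A abelian_object_iff_inverse[OF A' n] by (auto simp: Hom_def)
    note [simp] = addition_simps[OF A' n] addition_zero[OF A' n] HomD[OF h]
    have nh: "n \<cdot> \<langle>h, i \<cdot> h\<rangle> = \<zero> X A"
    proof -
      have "n \<cdot> \<langle>h, i \<cdot> h\<rangle> = n \<cdot> \<langle>\<I> A, i\<rangle> \<cdot> h" by simp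
      then show ?thesis by (simp only: ni) simp
    qed
    \<comment> \<open>The map \<open>(a, b) \<mapsto> h a - h b\<close>.\<close>
    define e where "e = n \<cdot> \<langle>h \<cdot> \<pi>\<^sub>1 X X, i \<cdot> (h \<cdot> \<pi>\<^sub>2 X X)\<rangle>"
    have e [simp]: "e \<in> Arr C" "Dom C e = P" "Cod C e = A" by (simp_all add: e_def)
    have "e \<cdot> d = e \<cdot> \<zero> X P" by (simp add: e_def d_def nh)
    then obtain k where k [simp]: "k \<in> Arr C" "Dom C k = Q" "Cod C k = A" and kq: "k \<cdot> q = e"
      using coequaliser_factor[OF q, of e] by auto
    have "k \<cdot> \<eta> = e \<cdot> \<langle>\<I> X, \<zero> X X\<rangle>" by (simp add: \<eta>_def flip: kq)
    also have "\<dots> = h" by (simp add: e_def)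
    finally have k\<eta>: "k \<cdot> \<eta> = h" .
    have "g = k" if g: "g \<in> Hom C Q A" and g\<eta>: "g \<cdot> \<eta> = h" for g
    proof (rule coequaliser_epi[OF q])
      note [simp] = HomD[OF g]
      \<comment> \<open>By \<open>g \<circ> q = h a + l b\<close> and the diagonal, \<open>l\<close> is forced to be the negative of \<open>h\<close>.\<close>
      define l where "l = g \<cdot> q \<cdot> \<langle>\<zero> X X, \<I> X\<rangle>"
      have l [simp]: "l \<in> Arr C" "Dom C l = X" "Cod C l = A" by (simp_all add: l_def)
      have gq: "g \<cdot> q = n \<cdot> \<langle>h \<cdot> \<pi>\<^sub>1 X X, l \<cdot> \<pi>\<^sub>2 X X\<rangle>"
      proof -
        have "g \<cdot> q \<cdot> \<langle>\<I> X, \<zero> X X\<rangle> = h" by (simp add: \<eta>_def flip: g\<eta>)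
        then show ?thesis
          using arr_from_product_eq[OF A' n, of "g \<cdot> q" X X] unfolding l_def by simp
      qed
      have "n \<cdot> \<langle>h, l\<rangle> = g \<cdot> q \<cdot> d" unfolding gq by (simp add: d_def)
      also have "\<dots> = \<zero> X A" by (simp add: qd)
      finally have "l = i \<cdot> h"
        using addition_inverse_unique[OF A' n, of h l "i \<cdot> h" X] nh by simp
      then show "g \<cdot> q = k \<cdot> q" by (simp add: gq kq e_def)
    qed (use g in \<open>auto simp: Hom_def\<close>)
    moreover have "k \<in> Hom C Q A" by (simp add: Hom_def)
    ultimately show ?thesis using k\<eta> by blast
  qed
  show ?thesis
  proof (intro bexI ballI)
    fix A h assume "A \<in> {A. abelian_object C A}" "h \<in> Hom C X A"
    then show "\<exists>!k. k \<in> Hom C Q A \<and> k \<cdot> \<eta> = h" by (simp only: mem_Collect_eq univ)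
  qed (simp_all only: mem_Collect_eq ab \<eta>)
qed

end

section \<open>Abelian objects are reflective among commutative objects\<close>

theorem proposition3p22:
  fixes C :: "('o, 'm) cat"
  assumes "category C"
    and "pointed C"
    and "has_binary_products C"
    and "has_coequalisers C"
    and "products_commute_with_coequalisers C"
    and "condition_T C"
  shows "reflective_subcategory (Ab C) (Com C)"
proof -
  interpret category C by fact
  interpret products_commuting_with_coequalisers C
    by unfold_locales fact+
  show ?thesis
    unfolding Ab_def Com_def
  proof (rule reflective_full_subcatI)
    fix A assume "A \<in> {X. commutative_object C X}"
    then show "\<exists>Q\<in>{A. abelian_object C A}. \<exists>\<eta>\<in>Hom C A Q. \<forall>B\<in>{A. abelian_object C A}.
        \<forall>h\<in>Hom C A B. \<exists>!k. k \<in> Hom C Q B \<and> k \<cdot>\<^bsub>C\<^esub> \<eta> = h"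
      using group_completion by simp
  qed (use assms(1) in \<open>auto simp: abelian_object_def commutative_object_def\<close>)
qed

end
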